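(* Let $U\in\mathbb{R}^{n\times n}$. (a) Let $\rho\ge 0$ and $\mathcal{Z}=\{\Delta\in\mathbb{R}^{n\times n}:\ \|\Delta\|\le\rho\}$, where $\|\cdot\|$ is a general matrix norm. Then $\delta^*_{\mathcal{Z}}(U)=\rho\|U\|^*$. (b) Let $\mathcal{Z}=\{\Delta:\ \Delta^l\preceq\Delta\preceq\Delta^u\}$, where $\Delta^l,\Delta^u$ are given symmetric $n\times n$ matrices such that $\Delta^u-\Delta^l\succ 0_{n\times n}$. Then $$\delta^*_{\mathcal{Z}}(U)=\min_{\Lambda_1,\Lambda_2}\left\{\mathrm{trace}(\Delta^u\Lambda_2)-\mathrm{trace}(\Delta^l\Lambda_1):\ \Lambda_2-\Lambda_1=\frac{U+U^T}{2},\ \Lambda_1,\Lambda_2\succeq 0_{n\times n}\right\}.$$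
   Context: Support function: for a convex set $\mathcal{Z}\subseteq\mathbb{R}^{n\times n}$, $\delta^*_{\mathcal{Z}}(U):=\sup_{\Delta\in\mathcal{Z}}\mathrm{trace}(\Delta U^T)$. Dual norm of a matrix norm $\|\cdot\|$ (any norm on the vector space $\mathbb{R}^{n\times n}$): $\|A\|^*=\max_{\|B\|=1}\mathrm{trace}(B^TA)$. $M\succeq N$ (resp. $M\succ N$) means that $M-N$ is symmetric positive semi-definite (resp. symmetric positive definite); in particular the elements of $\mathcal{Z}$ in (b) are symmetric. *)

theory Defs
  imports "HOL-Analysis.Analysis"
begin

definition matrix_norm :: "(real^'n^'n \<Rightarrow> real) \<Rightarrow> bool" where
  "matrix_norm N \<longleftrightarrow>
     (\<forall>A. 0 \<le> N A) \<and> (\<forall>A. N A = 0 \<longleftrightarrow> A = 0) \<and>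
     (\<forall>c A. N (c *\<^sub>R A) = \<bar>c\<bar> * N A) \<and> (\<forall>A B. N (A + B) \<le> N A + N B)"

text \<open>The maximum is \<^const>\<open>Greatest\<close>; it is attained whenever \<open>N\<close> is a norm, see
  \<open>dual_norm_max\<close> below.\<close>

definition dual_norm :: "(real^'n^'n \<Rightarrow> real) \<Rightarrow> real^'n^'n \<Rightarrow> real" where
  "dual_norm N A = (GREATEST t. \<exists>B. N B = 1 \<and> t = trace (transpose B ** A))"

text \<open>Extended real values, so that the supremum is meaningful for unbounded sets as well.\<close>

definition support_function :: "(real^'n^'n) set \<Rightarrow> real^'n^'n \<Rightarrow> ereal" where
  "support_function Z U = (SUP D\<in>Z. ereal (trace (D ** transpose U)))"

definition psd :: "real^'n^'n \<Rightarrow> bool" where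
  "psd A \<longleftrightarrow> transpose A = A \<and> (\<forall>x. 0 \<le> x \<bullet> (A *v x))"

definition pd :: "real^'n^'n \<Rightarrow> bool" where
  "pd A \<longleftrightarrow> transpose A = A \<and> (\<forall>x. x \<noteq> 0 \<longrightarrow> 0 < x \<bullet> (A *v x))"

definition loewner_le :: "real^'n^'n \<Rightarrow> real^'n^'n \<Rightarrow> bool" (infix "\<preceq>\<^sub>L" 50) where
  "A \<preceq>\<^sub>L B \<longleftrightarrow> psd (B - A)"

definition loewner_less :: "real^'n^'n \<Rightarrow> real^'n^'n \<Rightarrow> bool" (infix "\<prec>\<^sub>L" 50) where
  "A \<prec>\<^sub>L B \<longleftrightarrow> pd (B - A)"

lemma matrix_norm_lipschitz:
  fixes N :: "real^'n^'n \<Rightarrow> real"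
  assumes N: "matrix_norm N"
  obtains C where "0 \<le> C" and "\<And>A B. \<bar>N A - N B\<bar> \<le> C * norm (A - B)"
proof
  have scale: "N (c *\<^sub>R A) = \<bar>c\<bar> * N A" and tri: "N (A + B) \<le> N A + N B"
    and nn: "0 \<le> N A" and zero: "N 0 = 0" for c A B
    using N unfolding matrix_norm_def by auto
  let ?C = "\<Sum>b\<in>Basis. N b"
  show "0 \<le> ?C" by (simp add: nn sum_nonneg)
  have bound: "N A \<le> ?C * norm A" for A
  proof -
    have sum_le: "N (\<Sum>b\<in>S. f b) \<le> (\<Sum>b\<in>S. N (f b))" if "finite S"
      for S and f :: "real^'n^'n \<Rightarrow> real^'n^'n"
      using that
    proof induction
      case (insert x F)
      then show ?case using tri[of "f x" "sum f F"] by simp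
    qed (simp add: zero)
    have "N A = N (\<Sum>b\<in>Basis. (A \<bullet> b) *\<^sub>R b)" by (simp add: euclidean_representation)
    also have "\<dots> \<le> (\<Sum>b\<in>Basis. N ((A \<bullet> b) *\<^sub>R b))" by (rule sum_le) simp
    also have "\<dots> \<le> (\<Sum>b\<in>Basis. norm A * N b)"
      by (rule sum_mono) (simp add: scale nn Basis_le_norm mult_right_mono)
    finally show ?thesis by (simp add: sum_distrib_left mult.commute)
  qed
  show "\<bar>N A - N B\<bar> \<le> ?C * norm (A - B)" for A B
  proof -
    have "N (B - A) = N (A - B)" using scale[of "-1" "A - B"] by simp
    then show ?thesis
      using tri[of "A - B" B] tri[of "B - A" A] bound[of "A - B"] by simp
  qed
qed

lemma dual_norm_max:
  fixes N :: "real^'n^'n \<Rightarrow> real"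
  assumes N: "matrix_norm N"
  shows "\<exists>B. N B = 1 \<and> dual_norm N A = trace (transpose B ** A)"
    and "N B = 1 \<Longrightarrow> trace (transpose B ** A) \<le> dual_norm N A"
proof -
  have scale: "N (c *\<^sub>R A) = \<bar>c\<bar> * N A"
    and nn: "0 \<le> N A" and zero: "N A = 0 \<longleftrightarrow> A = 0" for c A
    using N unfolding matrix_norm_def by auto
  obtain C where "0 \<le> C" and C: "\<And>A B. \<bar>N A - N B\<bar> \<le> C * norm (A - B)"
    using matrix_norm_lipschitz[OF N] by blast
  have cont: "continuous_on S N" for S
    by (rule lipschitz_on_continuous_on[where L=C], rule lipschitz_onI)
      (use \<open>0 \<le> C\<close> C in \<open>auto simp: dist_norm\<close>)
  have tr: "trace (transpose B ** A) = B \<bullet> A" for B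
    unfolding trace_def matrix_matrix_mult_def transpose_def inner_vec_def
    by simp (rule sum.swap)
  have "sphere (0::real^'n^'n) 1 \<noteq> {}" by simp
  then obtain X where X: "X \<in> sphere 0 1" "\<And>Y. Y \<in> sphere 0 1 \<Longrightarrow> N X \<le> N Y"
    using continuous_attains_inf[OF compact_sphere _ cont] by metis
  have "X \<noteq> 0" using X(1) by auto
  then have pos: "0 < N X" using nn[of X] zero[of X] by linarith
  have low: "N X * norm Y \<le> N Y" for Y
  proof (cases "Y = 0")
    case False
    then have "N X \<le> N ((1 / norm Y) *\<^sub>R Y)" by (intro X(2)) simp
    with False show ?thesis by (simp add: scale field_simps)
  qed (simp add: nn)
  have "closed {B. N B = 1}"
    using continuous_closed_preimage[OF cont[of UNIV], of "{1}"] by (simp add: vimage_def)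
  moreover have "bounded {B. N B = 1}"
    by (rule boundedI[where B="1 / N X"])
      (use low pos in \<open>auto simp: field_simps\<close>, metis)
  ultimately have "compact {B. N B = 1}" by (simp add: compact_eq_bounded_closed)
  moreover have "(1 / N X) *\<^sub>R X \<in> {B. N B = 1}" using pos by (simp add: scale)
  moreover have "continuous_on {B. N B = 1} (\<lambda>B. B \<bullet> A)" by (intro continuous_intros)
  ultimately obtain M where M: "N M = 1" "\<And>B. N B = 1 \<Longrightarrow> B \<bullet> A \<le> M \<bullet> A"
    using continuous_attains_sup[of "{B. N B = 1}" "\<lambda>B. B \<bullet> A"]
    by blast
  have dn: "dual_norm N A = M \<bullet> A"
    unfolding dual_norm_def tr by (rule Greatest_equality) (use M in auto)
  show "\<exists>B. N B = 1 \<and> dual_norm N A = trace (transpose B ** A)"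
    using M(1) dn tr by auto
  show "N B = 1 \<Longrightarrow> trace (transpose B ** A) \<le> dual_norm N A"
    using M(2) dn tr by simp
qed

end

theory Submission
  imports Defs
begin

text \<open>
  Part (a) is homogeneity of the trace pairing. Part (b) is an instance of conic duality in a
  Euclidean space: if \<open>K\<close> is a closed convex cone with dual cone \<open>K\<^sup>*\<close> and \<open>u - l\<close> is positive on
  \<open>K - {0}\<close>, then the supremum of \<open>\<langle>d, s\<rangle>\<close> over \<open>d - l \<in> K\<^sup>*\<close>, \<open>u - d \<in> K\<^sup>*\<close> is the minimum of
  \<open>\<langle>u, q\<rangle> - \<langle>l, p\<rangle>\<close> over \<open>p, q \<in> K\<close>, \<open>q - p = s\<close>. Positivity makes the epigraph of the minimal
  value, as a function of \<open>s\<close>, a closed cone; a hyperplane \<open>(- d, 1)\<close> that separates a point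
  below the minimal value from it yields an admissible \<open>d\<close> with a larger \<open>\<langle>d, s\<rangle>\<close>. For the
  semidefinite cone, self-duality among symmetric matrices comes from its generation by the
  matrices \<open>v v\<^sup>T\<close>.
\<close>

section \<open>Duality for order intervals of a cone\<close>

definition dual_cone :: "'a::real_inner set \<Rightarrow> 'a set" where
  "dual_cone K = {y. \<forall>x\<in>K. 0 \<le> y \<bullet> x}"

lemma dual_coneI: "(\<And>x. x \<in> K \<Longrightarrow> 0 \<le> y \<bullet> x) \<Longrightarrow> y \<in> dual_cone K"
  by (simp add: dual_cone_def)

lemma dual_coneD: "y \<in> dual_cone K \<Longrightarrow> x \<in> K \<Longrightarrow> 0 \<le> y \<bullet> x"
  by (simp add: dual_cone_def)

lemma dual_cone_scaleR: "y \<in> dual_cone K \<Longrightarrow> 0 \<le> c \<Longrightarrow> c *\<^sub>R y \<in> dual_cone K"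
  by (simp add: dual_cone_def)

lemma separating_dual_cone:
  fixes C :: "'a::euclidean_space set"
  assumes "closed C" and C: "convex_cone C" and "z \<notin> C"
  obtains a where "a \<in> dual_cone C" "a \<bullet> z < 0"
proof -
  have "convex C" using C by (simp add: convex_cone_def)
  then obtain a b where below: "a \<bullet> z < b" and above: "\<And>x. x \<in> C \<Longrightarrow> b < a \<bullet> x"
    using separating_hyperplane_closed_point[OF _ \<open>closed C\<close> \<open>z \<notin> C\<close>] by blast
  have "b < 0" using above[of 0] C by (simp add: convex_cone_contains_0)
  have "a \<in> dual_cone C"
  proof (rule dual_coneI, rule ccontr)
    fix x assume "x \<in> C" and neg: "\<not> 0 \<le> a \<bullet> x"
    have "(b / (a \<bullet> x)) *\<^sub>R x \<in> C"
      using convex_cone_scaleR[OF C _ \<open>x \<in> C\<close>] neg \<open>b < 0\<close> by (simp add: divide_nonpos_neg)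
    from above[OF this] neg show False by simp
  qed
  with below \<open>b < 0\<close> show ?thesis by (intro that[of a]) auto
qed

lemma conic_eq_conic_hull_sphere:
  fixes C :: "'a::real_normed_vector set"
  assumes "conic C" and "\<not> C \<subseteq> {0}"
  shows "conic hull (C \<inter> sphere 0 1) = C"
proof
  show "conic hull (C \<inter> sphere 0 1) \<subseteq> C"
    using \<open>conic C\<close> by (intro hull_minimal) auto
next
  have normalized: "(1 / norm x) *\<^sub>R x \<in> C \<inter> sphere 0 1" if "x \<in> C" "x \<noteq> 0" for x
    using conicD[OF \<open>conic C\<close> that(1), of "1 / norm x"] that(2) by simp
  show "C \<subseteq> conic hull (C \<inter> sphere 0 1)"
  proof
    fix x assume "x \<in> C"
    show "x \<in> conic hull (C \<inter> sphere 0 1)"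
    proof (cases "x = 0")
      case True
      with normalized \<open>\<not> C \<subseteq> {0}\<close> show ?thesis by (auto simp only: conic_hull_contains_0)
    next
      case False
      then have "x = norm x *\<^sub>R ((1 / norm x) *\<^sub>R x)" by simp
      then show ?thesis
        using normalized[OF \<open>x \<in> C\<close> False] norm_ge_zero unfolding conic_hull_explicit by blast
    qed
  qed
qed

lemma closed_conic_linear_image:
  fixes f :: "'a::euclidean_space \<Rightarrow> 'b::euclidean_space"
  assumes "closed C" "conic C" "linear f"
    and kernel: "\<And>x. x \<in> C \<Longrightarrow> f x = 0 \<Longrightarrow> x = 0"
  shows "closed (f ` C)"
proof (cases "C \<subseteq> {0}")
  case True
  then have "finite (f ` C)" by (intro finite_imageI finite_subset[OF True]) simp
  then show ?thesis by (rule finite_imp_closed)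
next
  case False
  let ?B = "C \<inter> sphere 0 1"
  have "compact (f ` ?B)"
    using \<open>closed C\<close> \<open>linear f\<close>
    by (intro compact_continuous_image linear_continuous_on closed_Int_compact)
      (simp_all add: linear_linear)
  moreover have "0 \<notin> f ` ?B" using kernel by fastforce
  ultimately have "closed (conic hull (f ` ?B))" by (intro closed_conic_hull) simp
  then show ?thesis
    by (simp add: conic_hull_linear_image \<open>linear f\<close> conic_eq_conic_hull_sphere \<open>conic C\<close> False)
qed

definition dual_interval :: "'a::real_inner set \<Rightarrow> 'a \<Rightarrow> 'a \<Rightarrow> 'a set" where
  "dual_interval K l u = {d. d - l \<in> dual_cone K \<and> u - d \<in> dual_cone K}"

lemma dual_interval_weak_duality:
  assumes "d \<in> dual_interval K l u" "p \<in> K" "q \<in> K"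
  shows "d \<bullet> (q - p) \<le> u \<bullet> q - l \<bullet> p"
proof -
  have "0 \<le> (u - d) \<bullet> q" "0 \<le> (d - l) \<bullet> p"
    using assms by (auto simp: dual_interval_def dual_cone_def)
  then show ?thesis by (simp add: inner_diff_left inner_diff_right)
qed

definition interval_epigraph :: "'a::real_inner set \<Rightarrow> 'a \<Rightarrow> 'a \<Rightarrow> ('a \<times> real) set" where
  "interval_epigraph K l u = (\<lambda>(p, q, r). (q - p, u \<bullet> q - l \<bullet> p + r)) ` (K \<times> K \<times> {0..})"

lemma linear_interval_epigraph_map: "linear (\<lambda>(p, q, r). (q - p, u \<bullet> q - l \<bullet> p + r))"
  by (rule linearI) (auto simp: algebra_simps)

lemma convex_cone_interval_epigraph:
  assumes "convex_cone K"
  shows "convex_cone (interval_epigraph K l u)"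
proof -
  have "convex_cone (K \<times> K \<times> {0::real..})"
    using assms by (auto simp: convex_cone_iff zero_prod_def)
  then show ?thesis
    unfolding interval_epigraph_def
    by (intro convex_cone_linear_image conjI linear_interval_epigraph_map)
qed

lemma closed_interval_epigraph:
  fixes K :: "'a::euclidean_space set"
  assumes "closed K" "convex_cone K" and pos: "\<And>x. x \<in> K \<Longrightarrow> x \<noteq> 0 \<Longrightarrow> l \<bullet> x < u \<bullet> x"
  shows "closed (interval_epigraph K l u)"
  unfolding interval_epigraph_def
proof (rule closed_conic_linear_image[OF _ _ linear_interval_epigraph_map])
  show "closed (K \<times> K \<times> {0::real..})"
    using \<open>closed K\<close> by (intro closed_Times closed_atLeast)
  show "conic (K \<times> K \<times> {0::real..})"
    using \<open>convex_cone K\<close> by (auto simp: convex_cone_def conic_def)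
  fix x assume "x \<in> K \<times> K \<times> {0::real..}" "(\<lambda>(p, q, r). (q - p, u \<bullet> q - l \<bullet> p + r)) x = 0"
  then obtain p r where "x = (p, p, r)" "p \<in> K" "0 \<le> r" "u \<bullet> p - l \<bullet> p + r = 0"
    by (auto simp: zero_prod_def)
  with pos[of p] show "x = 0" by (cases "p = 0") (auto simp: zero_prod_def)
qed

lemma dual_cone_interval_epigraphD:
  assumes "0 \<in> K" "(y, t) \<in> dual_cone (interval_epigraph K l u)"
  shows "y + t *\<^sub>R u \<in> dual_cone K" "- y - t *\<^sub>R l \<in> dual_cone K" "0 \<le> t"
proof -
  have nonneg: "0 \<le> y \<bullet> (q - p) + t * (u \<bullet> q - l \<bullet> p + r)" if "p \<in> K" "q \<in> K" "0 \<le> r" for p q r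
    using that dual_coneD[OF assms(2), of "(q - p, u \<bullet> q - l \<bullet> p + r)"]
    by (force simp: interval_epigraph_def)
  show "y + t *\<^sub>R u \<in> dual_cone K"
    using nonneg[of 0 _ 0] \<open>0 \<in> K\<close> by (intro dual_coneI) (simp add: inner_add_left)
  show "- y - t *\<^sub>R l \<in> dual_cone K"
    using nonneg[of _ 0 0] \<open>0 \<in> K\<close> by (intro dual_coneI) (simp add: inner_diff_left)
  show "0 \<le> t" using nonneg[of 0 0 1] \<open>0 \<in> K\<close> by simp
qed

lemma dual_interval_strong_duality:
  fixes K :: "'a::euclidean_space set"
  assumes K: "closed K" "convex_cone K"
    and pos: "\<And>x. x \<in> K \<Longrightarrow> x \<noteq> 0 \<Longrightarrow> l \<bullet> x < u \<bullet> x"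
    and feasible: "p\<^sub>0 \<in> K" "q\<^sub>0 \<in> K" "q\<^sub>0 - p\<^sub>0 = s"
    and bound: "\<And>d. d \<in> dual_interval K l u \<Longrightarrow> d \<bullet> s \<le> m"
  obtains p q where "p \<in> K" "q \<in> K" "q - p = s" "u \<bullet> q - l \<bullet> p \<le> m"
proof -
  have "(s, m) \<in> interval_epigraph K l u"
  proof (rule ccontr)
    assume "(s, m) \<notin> interval_epigraph K l u"
    then obtain y t where separating: "(y, t) \<in> dual_cone (interval_epigraph K l u)"
      and "(y, t) \<bullet> (s, m) < 0"
      using separating_dual_cone closed_interval_epigraph convex_cone_interval_epigraph K pos
      by (metis surj_pair)
    then have neg: "y \<bullet> s + t * m < 0" by simp
    note dual = dual_cone_interval_epigraphD[OF convex_cone_contains_0[OF K(2)] separating]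
    show False
    proof (cases "t = 0")
      case True
      then have "0 \<le> y \<bullet> q\<^sub>0" "0 \<le> - y \<bullet> p\<^sub>0"
        using dual(1,2) feasible(1,2) by (auto dest: dual_coneD)
      with neg True feasible(3) show False by (auto simp: inner_diff_right)
    next
      case False
      with dual(3) have "0 < t" by simp
      define d where "d = - (1 / t) *\<^sub>R y"
      have "d - l = (1 / t) *\<^sub>R (- y - t *\<^sub>R l)" "u - d = (1 / t) *\<^sub>R (y + t *\<^sub>R u)"
        using \<open>0 < t\<close> by (simp_all add: d_def algebra_simps)
      then have "d \<in> dual_interval K l u"
        using dual_cone_scaleR[OF dual(1), of "1 / t"] dual_cone_scaleR[OF dual(2), of "1 / t"]
          \<open>0 < t\<close> by (simp add: dual_interval_def)
      from bound[OF this] neg \<open>0 < t\<close> show False by (simp add: d_def field_simps)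
    qed
  qed
  then show ?thesis by (auto simp: interval_epigraph_def intro: that)
qed

theorem SUP_inner_dual_interval:
  fixes K :: "'a::euclidean_space set"
  assumes K: "closed K" "convex_cone K"
    and pos: "\<And>x. x \<in> K \<Longrightarrow> x \<noteq> 0 \<Longrightarrow> l \<bullet> x < u \<bullet> x"
    and feasible: "p\<^sub>0 \<in> K" "q\<^sub>0 \<in> K" "q\<^sub>0 - p\<^sub>0 = s"
  obtains p q where "p \<in> K" "q \<in> K" "q - p = s"
    and "(SUP d\<in>dual_interval K l u. ereal (d \<bullet> s)) = ereal (u \<bullet> q - l \<bullet> p)"
proof -
  let ?sup = "SUP d\<in>dual_interval K l u. ereal (d \<bullet> s)"
  have weak: "?sup \<le> ereal (u \<bullet> q - l \<bullet> p)" if "p \<in> K" "q \<in> K" "q - p = s" for p q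
    using dual_interval_weak_duality that by (intro SUP_least) fastforce
  have "0 \<le> (u - l) \<bullet> x" if "x \<in> K" for x
    using pos[OF that] by (cases "x = 0") (auto simp: inner_diff_left)
  then have "l \<in> dual_interval K l u" by (simp add: dual_interval_def dual_cone_def)
  then have "ereal (l \<bullet> s) \<le> ?sup" by (rule SUP_upper)
  with weak[OF feasible] obtain m where m: "?sup = ereal m" by (cases ?sup) auto
  then have "d \<bullet> s \<le> m" if "d \<in> dual_interval K l u" for d
    using SUP_upper[OF that, of "\<lambda>d. ereal (d \<bullet> s)"] by simp
  then obtain p q where optimal: "p \<in> K" "q \<in> K" "q - p = s" "u \<bullet> q - l \<bullet> p \<le> m"
    using dual_interval_strong_duality[OF K pos feasible] by blast
  with weak[OF optimal(1-3)] m show ?thesis by (intro that[of p q]) auto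
qed

section \<open>The trace inner product\<close>

lemma trace_mult_eq_inner:
  fixes A :: "real^'n^'m" and B :: "real^'m^'n"
  shows "trace (A ** B) = transpose A \<bullet> B"
  unfolding trace_def matrix_matrix_mult_def transpose_def inner_vec_def
  by simp (rule sum.swap)

lemma inner_transpose_transpose:
  fixes A B :: "real^'n^'m"
  shows "transpose A \<bullet> transpose B = A \<bullet> B"
  unfolding transpose_def inner_vec_def by simp (rule sum.swap)

lemma transpose_add:
  fixes A B :: "'a::plus^'n^'m"
  shows "transpose (A + B) = transpose A + transpose B"
  by (simp add: transpose_def vec_eq_iff)

lemma transpose_diff:
  fixes A B :: "'a::minus^'n^'m"
  shows "transpose (A - B) = transpose A - transpose B"
  by (simp add: transpose_def vec_eq_iff)

lemma transpose_zero [simp]: "transpose (0 :: 'a::zero^'n^'m) = 0"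
  by (simp add: transpose_def vec_eq_iff)

lemma inner_mult_vec_commute:
  fixes A :: "real^'n^'n"
  assumes "transpose A = A"
  shows "x \<bullet> (A *v y) = y \<bullet> (A *v x)"
  using dot_lmul_matrix[of x A y] assms by (metis inner_commute transpose_matrix_vector)

definition sym_part :: "real^'n^'n \<Rightarrow> real^'n^'n" where
  "sym_part A = (1/2) *\<^sub>R (A + transpose A)"

lemma transpose_sym_part [simp]: "transpose (sym_part A) = sym_part A"
  by (simp add: sym_part_def transpose_scalar transpose_add add.commute)

lemma sym_part_eq_self: "transpose A = A \<Longrightarrow> sym_part A = A"
  by (simp add: sym_part_def flip: scaleR_2)

lemma sym_part_diff: "sym_part (A - B) = sym_part A - sym_part B"
  by (simp add: sym_part_def transpose_diff algebra_simps)

lemma inner_sym_part: "sym_part A \<bullet> B = A \<bullet> sym_part B"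
  using inner_transpose_transpose[of A "transpose B"]
  by (simp add: sym_part_def inner_add_left inner_add_right)

section \<open>The semidefinite cone\<close>

definition outer_self :: "real^'n \<Rightarrow> real^'n^'n" where
  "outer_self v = (\<chi> i j. v $ i * v $ j)"

lemma transpose_outer_self [simp]: "transpose (outer_self v) = outer_self v"
  by (simp add: outer_self_def transpose_def vec_eq_iff mult.commute)

lemma outer_self_mult_vec: "outer_self v *v x = (v \<bullet> x) *\<^sub>R v"
  by (simp add: outer_self_def matrix_vector_mult_def inner_vec_def vec_eq_iff
      sum_distrib_left sum_distrib_right ac_simps)

lemma inner_outer_self: "A \<bullet> outer_self v = v \<bullet> (A *v v)"
  by (simp add: outer_self_def matrix_vector_mult_def inner_vec_def sum_distrib_left ac_simps)

lemma psd_outer_self: "psd (outer_self v)"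
  by (simp add: psd_def outer_self_mult_vec inner_commute)

lemma psd_iff_inner_outer_self: "psd A \<longleftrightarrow> transpose A = A \<and> (\<forall>v. 0 \<le> A \<bullet> outer_self v)"
  by (simp add: psd_def inner_outer_self)

lemma convex_cone_psd: "convex_cone (Collect psd)"
  by (simp add: convex_cone_iff psd_iff_inner_outer_self transpose_add transpose_scalar
      inner_add_left)

lemma closed_psd: "closed (Collect psd :: (real^'n^'n) set)"
proof -
  have "closed {A :: real^'n^'n. transpose A = A}"
    unfolding transpose_def vec_eq_iff
    by (intro closed_Collect_all closed_Collect_eq continuous_intros)
  moreover have "closed {A :: real^'n^'n. \<forall>v. 0 \<le> A \<bullet> outer_self v}"
    by (intro closed_Collect_all closed_Collect_le continuous_intros)
  ultimately show ?thesis
    unfolding psd_iff_inner_outer_self by (rule closed_Collect_conj)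
qed

lemma symmetric_eq_0_if_quadratic_form_0:
  fixes A :: "real^'n^'n"
  assumes sym: "transpose A = A" and form: "\<And>x. x \<bullet> (A *v x) = 0"
  shows "A = 0"
proof -
  have "x \<bullet> (A *v y) = 0" for x y
    using form[of "x + y"] form[of x] form[of y] inner_mult_vec_commute[OF sym, of x y]
    by (simp add: matrix_vector_right_distrib inner_add_left inner_add_right)
  then have "A *v y = 0" for y using inner_eq_zero_iff by blast
  then show ?thesis by (simp add: matrix_eq)
qed

text \<open>
  The reduction \<open>A - (A v) (A v)\<^sup>T / (v \<bullet> A v)\<close> is the congruence of \<open>A\<close> by the projection along \<open>v\<close>
  onto the kernel of \<open>x \<mapsto> x \<bullet> A v\<close>. It is symmetric and annihilates \<open>v\<close>, so its range is orthogonal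
  to \<open>v\<close> and, unlike that of \<open>A\<close>, does not contain \<open>A v\<close>.
\<close>

lemma psd_rank_one_reduction:
  fixes A :: "real^'n^'n"
  assumes A: "psd A" and "A \<noteq> 0"
  obtains w where "psd (A - outer_self w)" and "rank (A - outer_self w) < rank A"
proof -
  have sym: "transpose A = A" and nonneg: "0 \<le> x \<bullet> (A *v x)" for x
    using A by (auto simp: psd_def)
  obtain v where "v \<bullet> (A *v v) \<noteq> 0"
    using symmetric_eq_0_if_quadratic_form_0[OF sym] \<open>A \<noteq> 0\<close> by blast
  with nonneg[of v] have vAv: "0 < v \<bullet> (A *v v)" by simp
  define proj where "proj x = x - ((x \<bullet> (A *v v)) / (v \<bullet> (A *v v))) *\<^sub>R v" for x
  define w where "w = (1 / sqrt (v \<bullet> (A *v v))) *\<^sub>R (A *v v)"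
  define B where "B = A - outer_self w"
  have B_mult: "B *v x = A *v proj x" for x
    using vAv by (simp add: B_def proj_def w_def matrix_vector_mult_diff_rdistrib
        matrix_vector_mult_diff_distrib matrix_vector_mult_scaleR outer_self_mult_vec inner_commute
        flip: real_sqrt_mult)
  have symB: "transpose B = B" by (simp add: B_def transpose_diff sym)
  have "proj v = 0" using vAv by (simp add: proj_def)
  then have v_orth: "v \<bullet> (B *v x) = 0" for x
    using inner_mult_vec_commute[OF symB, of v x] by (simp add: B_mult)
  have "x \<bullet> (B *v x) = proj x \<bullet> (A *v proj x)" for x
    using v_orth[of x] by (simp add: B_mult) (simp add: proj_def inner_diff_left)
  then have "psd B" using symB nonneg by (simp add: psd_def)
  have "A *v v \<notin> range ((*v) B)" using vAv v_orth by fastforce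
  moreover have "range ((*v) B) \<subseteq> range ((*v) A)" by (auto simp: B_mult)
  ultimately have "range ((*v) B) \<subset> range ((*v) A)" by blast
  moreover have "span (range ((*v) M)) = range ((*v) M)" for M :: "real^'n^'n"
    unfolding span_eq_iff by (simp add: linear_subspace_image)
  ultimately have "rank B < rank A" unfolding rank_dim_range by (metis dim_psubset)
  with \<open>psd B\<close> show ?thesis unfolding B_def by (rule that)
qed

lemma psd_induct [consumes 1, case_names zero add_outer_self]:
  fixes A :: "real^'n^'n"
  assumes "psd A"
    and zero: "P 0"
    and step: "\<And>B v. psd B \<Longrightarrow> P B \<Longrightarrow> P (B + outer_self v)"
  shows "P A"
  using \<open>psd A\<close>
proof (induction "rank A" arbitrary: A rule: less_induct)
  case less
  show ?case
  proof (cases "A = 0")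
    case False
    then obtain w where "psd (A - outer_self w)" "rank (A - outer_self w) < rank A"
      using psd_rank_one_reduction less.prems by blast
    then have "P (A - outer_self w + outer_self w)" by (intro step less.hyps)
    then show ?thesis by simp
  qed (simp add: zero)
qed

lemma psd_inner_nonneg:
  assumes "psd A" "psd B"
  shows "0 \<le> A \<bullet> B"
  using \<open>psd B\<close>
proof (induction B rule: psd_induct)
  case (add_outer_self B v)
  have "0 \<le> A \<bullet> outer_self v" using \<open>psd A\<close> by (simp add: psd_def inner_outer_self)
  with add_outer_self.IH show ?case by (simp add: inner_add_right)
qed simp

lemma pd_inner_psd_pos:
  assumes "pd W" "psd M" "M \<noteq> 0"
  shows "0 < W \<bullet> M"
proof -
  have "M = 0 \<or> 0 < W \<bullet> M"
    using \<open>psd M\<close>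
  proof (induction M rule: psd_induct)
    case (add_outer_self M v)
    show ?case
    proof (cases "v = 0")
      case True
      then have "outer_self v = 0" by (simp add: outer_self_def vec_eq_iff)
      with add_outer_self.IH show ?thesis by simp
    next
      case False
      then have "0 < W \<bullet> outer_self v" using \<open>pd W\<close> by (simp add: pd_def inner_outer_self)
      with add_outer_self.IH show ?thesis by (auto simp: inner_add_right)
    qed
  qed simp
  with \<open>M \<noteq> 0\<close> show ?thesis by simp
qed

lemma dual_cone_psd: "dual_cone (Collect psd) = {A. psd (sym_part A)}"
proof (intro set_eqI iffI CollectI)
  fix A :: "real^'n^'n"
  assume A: "A \<in> dual_cone (Collect psd)"
  have "0 \<le> sym_part A \<bullet> outer_self v" for v
    using dual_coneD[OF A, of "outer_self v"]
    by (simp add: psd_outer_self inner_sym_part sym_part_eq_self)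
  then show "psd (sym_part A)" by (simp add: psd_iff_inner_outer_self)
next
  fix A :: "real^'n^'n"
  assume "A \<in> {A. psd (sym_part A)}"
  then have "0 \<le> A \<bullet> M" if "psd M" for M
    using psd_inner_nonneg[of "sym_part A" M] that
    by (simp add: inner_sym_part sym_part_eq_self psd_def)
  then show "A \<in> dual_cone (Collect psd)" by (auto intro: dual_coneI)
qed

lemma symmetric_eq_diff_psd:
  fixes S :: "real^'n^'n"
  assumes "transpose S = S"
  obtains P Q where "psd P" "psd Q" "Q - P = S"
proof
  let ?P = "onorm ((*v) S) *\<^sub>R mat 1 :: real^'n^'n"
  have P_mult: "?P *v x = onorm ((*v) S) *\<^sub>R x" for x
    by (simp add: scaleR_matrix_vector_assoc[symmetric])
  have S_bound: "\<bar>x \<bullet> (S *v x)\<bar> \<le> onorm ((*v) S) * (x \<bullet> x)" for x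
  proof -
    have "\<bar>x \<bullet> (S *v x)\<bar> \<le> norm x * norm (S *v x)" by (rule Cauchy_Schwarz_ineq2)
    also have "\<dots> \<le> norm x * (onorm ((*v) S) * norm x)"
      by (intro mult_left_mono onorm) simp_all
    finally show ?thesis by (simp add: ac_simps power2_eq_square flip: power2_norm_eq_inner)
  qed
  show "psd ?P" by (simp add: psd_def P_mult transpose_scalar onorm_pos_le)
  have "0 \<le> x \<bullet> ((S + ?P) *v x)" for x
    using S_bound[of x] by (simp add: P_mult matrix_vector_mult_add_rdistrib inner_add_right)
  then show "psd (S + ?P)" using assms by (simp add: psd_def transpose_add transpose_scalar)
qed simp

section \<open>Support functions of norm balls and Loewner intervals\<close>

lemma support_function_eq_SUP_inner: "support_function Z U = (SUP D\<in>Z. ereal (D \<bullet> U))"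
  by (simp add: support_function_def trace_mult_eq_inner inner_transpose_transpose)

lemma inner_le_dual_norm: "matrix_norm N \<Longrightarrow> N B = 1 \<Longrightarrow> B \<bullet> A \<le> dual_norm N A"
  using dual_norm_max(2)[of N B A] by (simp add: trace_mult_eq_inner)

lemma dual_norm_attained:
  assumes "matrix_norm N"
  obtains B where "N B = 1" "B \<bullet> A = dual_norm N A"
  using dual_norm_max(1)[OF assms, of A] by (auto simp: trace_mult_eq_inner)

lemma matrix_norm_scaleR: "matrix_norm N \<Longrightarrow> N (c *\<^sub>R A) = \<bar>c\<bar> * N A"
  by (simp add: matrix_norm_def)

lemma dual_norm_nonneg:
  assumes "matrix_norm N"
  shows "0 \<le> dual_norm N A"
proof -
  obtain B where maximizer: "N B = 1" "B \<bullet> A = dual_norm N A"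
    using dual_norm_attained[OF assms] .
  have "N (- B) = 1" using matrix_norm_scaleR[OF assms, of "-1" B] maximizer(1) by simp
  from inner_le_dual_norm[OF assms this, of A] maximizer(2) show ?thesis by simp
qed

lemma inner_le_matrix_norm_mult_dual_norm:
  assumes N: "matrix_norm N"
  shows "D \<bullet> A \<le> N D * dual_norm N A"
proof (cases "D = 0")
  case True
  moreover have "N 0 = 0" using N by (simp add: matrix_norm_def)
  ultimately show ?thesis by simp
next
  case False
  with N have "0 < N D" by (metis matrix_norm_def order_le_less)
  then have "((1 / N D) *\<^sub>R D) \<bullet> A \<le> dual_norm N A"
    by (intro inner_le_dual_norm[OF N]) (simp add: matrix_norm_scaleR[OF N])
  with \<open>0 < N D\<close> show ?thesis by (simp add: field_simps)
qed

theorem support_function_norm_ball: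
  assumes N: "matrix_norm N" and "0 \<le> \<rho>"
  shows "support_function {D. N D \<le> \<rho>} U = ereal (\<rho> * dual_norm N U)"
  unfolding support_function_eq_SUP_inner
proof (rule antisym)
  have "D \<bullet> U \<le> \<rho> * dual_norm N U" if "N D \<le> \<rho>" for D
    using inner_le_matrix_norm_mult_dual_norm[OF N, of D U]
      mult_right_mono[OF that dual_norm_nonneg[OF N, of U]] by linarith
  then show "(SUP D\<in>{D. N D \<le> \<rho>}. ereal (D \<bullet> U)) \<le> ereal (\<rho> * dual_norm N U)"
    by (intro SUP_least) simp
next
  obtain B where "N B = 1" "B \<bullet> U = dual_norm N U"
    using dual_norm_attained[OF N] .
  then show "ereal (\<rho> * dual_norm N U) \<le> (SUP D\<in>{D. N D \<le> \<rho>}. ereal (D \<bullet> U))"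
    using \<open>0 \<le> \<rho>\<close> by (intro SUP_upper2[of "\<rho> *\<^sub>R B"]) (simp_all add: matrix_norm_scaleR[OF N])
qed

lemma loewner_interval_eq_sym_part_image:
  assumes "transpose Dl = Dl" "transpose Du = Du"
  shows "{D. Dl \<preceq>\<^sub>L D \<and> D \<preceq>\<^sub>L Du} = sym_part ` dual_interval (Collect psd) Dl Du"
proof -
  have mem: "D \<in> dual_interval (Collect psd) Dl Du \<longleftrightarrow> Dl \<preceq>\<^sub>L sym_part D \<and> sym_part D \<preceq>\<^sub>L Du" for D
    by (simp add: dual_interval_def dual_cone_psd loewner_le_def sym_part_diff sym_part_eq_self assms)
  have sym_part_fixed: "sym_part D = D" if "Dl \<preceq>\<^sub>L D" for D
  proof -
    have "transpose (D - Dl) = D - Dl" using that by (simp add: loewner_le_def psd_def)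
    then show ?thesis using assms(1) by (simp add: transpose_diff sym_part_eq_self)
  qed
  show ?thesis
  proof (intro subset_antisym subsetI)
    fix D assume "D \<in> {D. Dl \<preceq>\<^sub>L D \<and> D \<preceq>\<^sub>L Du}"
    then have "D \<in> dual_interval (Collect psd) Dl Du" "D = sym_part D"
      by (simp_all add: mem sym_part_fixed)
    then show "D \<in> sym_part ` dual_interval (Collect psd) Dl Du" by (rule rev_image_eqI)
  next
    fix D assume "D \<in> sym_part ` dual_interval (Collect psd) Dl Du"
    then show "D \<in> {D. Dl \<preceq>\<^sub>L D \<and> D \<preceq>\<^sub>L Du}" by (auto simp: mem)
  qed
qed

theorem support_function_loewner_interval:
  assumes sym: "transpose Dl = Dl" "transpose Du = Du" and pd: "0 \<prec>\<^sub>L Du - Dl"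
  obtains L1 L2 where "psd L1" "psd L2" "L2 - L1 = sym_part U"
    and "support_function {D. Dl \<preceq>\<^sub>L D \<and> D \<preceq>\<^sub>L Du} U = ereal (Du \<bullet> L2 - Dl \<bullet> L1)"
    and "\<And>M1 M2. psd M1 \<Longrightarrow> psd M2 \<Longrightarrow> M2 - M1 = sym_part U \<Longrightarrow>
      Du \<bullet> L2 - Dl \<bullet> L1 \<le> Du \<bullet> M2 - Dl \<bullet> M1"
proof -
  let ?I = "dual_interval (Collect psd) Dl Du"
  have support: "support_function {D. Dl \<preceq>\<^sub>L D \<and> D \<preceq>\<^sub>L Du} U = (SUP D\<in>?I. ereal (D \<bullet> sym_part U))"
    by (simp add: support_function_eq_SUP_inner loewner_interval_eq_sym_part_image sym
        image_image inner_sym_part)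
  have pos: "Dl \<bullet> M < Du \<bullet> M" if "M \<in> Collect psd" "M \<noteq> 0" for M
    using pd_inner_psd_pos[of "Du - Dl" M] pd that by (simp add: loewner_less_def inner_diff_left)
  obtain P Q where decomposition: "psd P" "psd Q" "Q - P = sym_part U"
    using symmetric_eq_diff_psd[OF transpose_sym_part] .
  obtain L1 L2 where optimal: "psd L1" "psd L2" "L2 - L1 = sym_part U"
    and sup: "(SUP D\<in>?I. ereal (D \<bullet> sym_part U)) = ereal (Du \<bullet> L2 - Dl \<bullet> L1)"
    using SUP_inner_dual_interval[OF closed_psd convex_cone_psd pos _ _ decomposition(3)]
      decomposition(1,2) by auto
  have "Du \<bullet> L2 - Dl \<bullet> L1 \<le> Du \<bullet> M2 - Dl \<bullet> M1"
    if "psd M1" "psd M2" "M2 - M1 = sym_part U" for M1 M2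
  proof -
    have "(SUP D\<in>?I. ereal (D \<bullet> sym_part U)) \<le> ereal (Du \<bullet> M2 - Dl \<bullet> M1)"
      using dual_interval_weak_duality[of _ "Collect psd" Dl Du M1 M2] that
      by (intro SUP_least) simp
    then show ?thesis by (simp add: sup)
  qed
  with optimal sup support show ?thesis by (intro that) simp_all
qed

theorem lemma3:
  fixes U :: "real^'n^'n"
  shows "(\<forall>(N :: real^'n^'n \<Rightarrow> real) (\<rho>::real). matrix_norm N \<and> 0 \<le> \<rho> \<longrightarrow>
            support_function {D. N D \<le> \<rho>} U = ereal (\<rho> * dual_norm N U)) \<and>
         (\<forall>(Dl :: real^'n^'n) (Du :: real^'n^'n).
            transpose Dl = Dl \<and> transpose Du = Du \<and> 0 \<prec>\<^sub>L Du - Dl \<longrightarrow>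
            (\<exists>L1 L2.
               is_arg_min (\<lambda>(M1, M2). trace (Du ** M2) - trace (Dl ** M1))
                 (\<lambda>(M1, M2). M2 - M1 = (1/2) *\<^sub>R (U + transpose U) \<and> 0 \<preceq>\<^sub>L M1 \<and> 0 \<preceq>\<^sub>L M2)
                 (L1, L2) \<and>
               support_function {D. Dl \<preceq>\<^sub>L D \<and> D \<preceq>\<^sub>L Du} U
                 = ereal (trace (Du ** L2) - trace (Dl ** L1))))"
proof (intro conjI allI impI; elim conjE)
  fix N :: "real^'n^'n \<Rightarrow> real" and \<rho> :: real
  assume "matrix_norm N" "0 \<le> \<rho>"
  then show "support_function {D. N D \<le> \<rho>} U = ereal (\<rho> * dual_norm N U)"
    by (rule support_function_norm_ball)
next
  fix Dl Du :: "real^'n^'n"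
  assume sym: "transpose Dl = Dl" "transpose Du = Du" and "0 \<prec>\<^sub>L Du - Dl"
  then obtain L1 L2 where "psd L1" "psd L2" "L2 - L1 = sym_part U"
    and "support_function {D. Dl \<preceq>\<^sub>L D \<and> D \<preceq>\<^sub>L Du} U = ereal (Du \<bullet> L2 - Dl \<bullet> L1)"
    and "\<And>M1 M2. psd M1 \<Longrightarrow> psd M2 \<Longrightarrow> M2 - M1 = sym_part U \<Longrightarrow>
      Du \<bullet> L2 - Dl \<bullet> L1 \<le> Du \<bullet> M2 - Dl \<bullet> M1"
    using support_function_loewner_interval[of Dl Du U] by blast
  then show "\<exists>L1 L2.
      is_arg_min (\<lambda>(M1, M2). trace (Du ** M2) - trace (Dl ** M1))
        (\<lambda>(M1, M2). M2 - M1 = (1/2) *\<^sub>R (U + transpose U) \<and> 0 \<preceq>\<^sub>L M1 \<and> 0 \<preceq>\<^sub>L M2) (L1, L2) \<and>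
      support_function {D. Dl \<preceq>\<^sub>L D \<and> D \<preceq>\<^sub>L Du} U = ereal (trace (Du ** L2) - trace (Dl ** L1))"
    by (intro exI[of _ L1] exI[of _ L2])
      (auto simp: is_arg_min_linorder loewner_le_def trace_mult_eq_inner sym sym_part_def)
qed

end
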